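(* Let $n\geqslant 1$ be an integer. For any $\alpha\in\mathcal{PIO}_{n}$, the following properties are equivalent: (i) $\alpha$ is a regular element of $\mathcal{PIO}_n$; (ii) for all $x\in\operatorname{Im}(\alpha)$, $\lvert x\alpha^{-1}\rvert>1$ implies $x\alpha^{-1}\cap\{\min(\operatorname{Dom}(\alpha)),\max(\operatorname{Dom}(\alpha))\}\neq\emptyset$; (iii) for all $x\in\operatorname{Im}(\alpha)$, $\lvert x\alpha^{-1}\rvert>1$ implies $x\in\{\min(\operatorname{Im}(\alpha)),\max(\operatorname{Im}(\alpha))\}$.
   Context: $\Omega_n=\{1,\ldots,n\}$ with its natural order. A partial transformation of $\Omega_n$ is a map $\alpha$ from a subset $\operatorname{Dom}(\alpha)\subseteq\Omega_n$ (possibly empty) into $\Omega_n$, with image $\operatorname{Im}(\alpha)$. Maps are written on the right and composed from left to right: $x(\alpha\beta)=(x\alpha)\beta$, with $\operatorname{Dom}(\alpha\beta)=\{x\in\operatorname{Dom}(\alpha)\mid x\alpha\in\operatorname{Dom}(\beta)\}$. $x\alpha^{-1}=\{y\in\operatorname{Dom}(\alpha)\mid y\alpha=x\}$. $\alpha$ is order-preserving if $x\leqslant y$ implies $x\alpha\leqslant y\alpha$ for all $x,y\in\operatorname{Dom}(\alpha)$. A subset $I\subseteq\Omega_n$ (possibly empty) is an interval if for all $x,y,z\in\Omega_n$, $x\leqslant y\leqslant z$ and $x,z\in I$ imply $y\in I$. $\mathcal{PIO}_n$ is the monoid, under composition, of all order-preserving partial transformations $\alpha$ of $\Omega_n$ such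 that $\operatorname{Dom}(\alpha)$ and $\operatorname{Im}(\alpha)$ are both intervals of $\Omega_n$ (it includes the empty transformation, for which (ii) and (iii) hold vacuously). An element $s$ of a semigroup $S$ is regular if there exists $t\in S$ such that $s=sts$. *)

theory Defs
  imports "HOL-Algebra.Group"
begin

definition Omega :: "nat \<Rightarrow> nat set" where
  "Omega n = {1..n}"

definition is_interval_of :: "nat set \<Rightarrow> nat set \<Rightarrow> bool" where
  "is_interval_of W I \<longleftrightarrow>
     I \<subseteq> W \<and> (\<forall>x\<in>W. \<forall>y\<in>W. \<forall>z\<in>W. x \<le> y \<and> y \<le> z \<and> x \<in> I \<and> z \<in> I \<longrightarrow> y \<in> I)"

definition order_preserving :: "(nat \<rightharpoonup> nat) \<Rightarrow> bool" where
  "order_preserving \<alpha> \<longleftrightarrow>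
     (\<forall>x\<in>dom \<alpha>. \<forall>y\<in>dom \<alpha>. x \<le> y \<longrightarrow> the (\<alpha> x) \<le> the (\<alpha> y))"

text \<open>Maps compose from left to right, \<open>x(\<alpha>\<beta>) = (x\<alpha>)\<beta>\<close>, whereas \<open>\<beta> \<circ>\<^sub>m \<alpha>\<close>
  applies \<open>\<alpha>\<close> first; hence the arguments are swapped in the product.\<close>

definition PIO :: "nat \<Rightarrow> (nat \<rightharpoonup> nat) monoid" where
  "PIO n =
     \<lparr>carrier = {\<alpha>. order_preserving \<alpha> \<and>
                   is_interval_of (Omega n) (dom \<alpha>) \<and> is_interval_of (Omega n) (ran \<alpha>)},
      mult = (\<lambda>\<alpha> \<beta>. \<beta> \<circ>\<^sub>m \<alpha>),
      one = Some |` Omega n\<rparr>"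

definition regular_element :: "('a, 'b) monoid_scheme \<Rightarrow> 'a \<Rightarrow> bool" where
  "regular_element S s \<longleftrightarrow>
     s \<in> carrier S \<and> (\<exists>t\<in>carrier S. s = s \<otimes>\<^bsub>S\<^esub> t \<otimes>\<^bsub>S\<^esub> s)"

definition preimage :: "('a \<rightharpoonup> 'b) \<Rightarrow> 'b \<Rightarrow> 'a set" where
  "preimage \<alpha> x = {y \<in> dom \<alpha>. \<alpha> y = Some x}"

lemma PIO_monoid: "monoid (PIO n)"
proof (rule monoidI)
  fix \<alpha> \<beta>
  assume a: "\<alpha> \<in> carrier (PIO n)" and b: "\<beta> \<in> carrier (PIO n)"
  let ?c = "\<beta> \<circ>\<^sub>m \<alpha>"
  have "order_preserving \<alpha>" and ia: "is_interval_of (Omega n) (dom \<alpha>)" "is_interval_of (Omega n) (ran \<alpha>)"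
    and "order_preserving \<beta>" and ib: "is_interval_of (Omega n) (dom \<beta>)" "is_interval_of (Omega n) (ran \<beta>)"
    using a b by (simp_all add: PIO_def)
  then have opa: "\<alpha> x = Some u \<Longrightarrow> \<alpha> y = Some v \<Longrightarrow> x \<le> y \<Longrightarrow> u \<le> v"
    and opb: "\<beta> x = Some u \<Longrightarrow> \<beta> y = Some v \<Longrightarrow> x \<le> y \<Longrightarrow> u \<le> v" for x y u v
    unfolding order_preserving_def by (metis domI option.sel)+
  have suba: "dom \<alpha> \<subseteq> Omega n" "ran \<alpha> \<subseteq> Omega n"
    and subb: "dom \<beta> \<subseteq> Omega n" "ran \<beta> \<subseteq> Omega n"
    using ia ib by (simp_all add: is_interval_of_def)
  have between: "y \<in> I"
    if "is_interval_of (Omega n) I" "x \<in> I" "z \<in> I" "x \<le> y" "y \<le> z" "y \<in> Omega n" for I x y z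
    using that unfolding is_interval_of_def by blast
  note da = between[OF ia(1)] and ra = between[OF ia(2)] and db = between[OF ib(1)] and rb = between[OF ib(2)]
  have op: "order_preserving ?c"
    unfolding order_preserving_def
  proof (intro ballI impI)
    fix x y assume "x \<in> dom ?c" "y \<in> dom ?c" and le: "x \<le> y"
    then obtain u v p q where "\<alpha> x = Some u" "\<alpha> y = Some v" "\<beta> u = Some p" "\<beta> v = Some q"
      by (auto simp: map_comp_def split: option.splits)
    then show "the (?c x) \<le> the (?c y)" using opb[OF _ _ opa[OF _ _ le]] by simp
  qed
  have dom: "is_interval_of (Omega n) (dom ?c)"
    unfolding is_interval_of_def
  proof (intro conjI ballI impI)
    show "dom ?c \<subseteq> Omega n"
      using suba by (auto simp: map_comp_def split: option.splits)
  next
    fix x y z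
    assume y: "y \<in> Omega n" and h: "x \<le> y \<and> y \<le> z \<and> x \<in> dom ?c \<and> z \<in> dom ?c"
    then have "\<exists>u. \<alpha> x = Some u \<and> u \<in> dom \<beta>" "\<exists>w. \<alpha> z = Some w \<and> w \<in> dom \<beta>"
      by (auto simp: map_comp_def split: option.splits)
    then obtain u w where u: "\<alpha> x = Some u" "u \<in> dom \<beta>" and w: "\<alpha> z = Some w" "w \<in> dom \<beta>"
      by blast
    have "y \<in> dom \<alpha>" by (rule da[of x z]) (use h y u w in auto)
    then obtain v where v: "\<alpha> y = Some v" by blast
    then have "v \<in> Omega n" using suba(2) by (meson ranI subsetD)
    moreover have "u \<le> v" "v \<le> w"
      using h opa[OF u(1) v] opa[OF v w(1)] by simp_all
    ultimately have "v \<in> dom \<beta>" using db[OF u(2) w(2)] by simp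
    with v show "y \<in> dom ?c" by (auto simp: map_comp_def)
  qed
  have ran: "is_interval_of (Omega n) (ran ?c)"
    unfolding is_interval_of_def
  proof (intro conjI ballI impI)
    show "ran ?c \<subseteq> Omega n"
      using subb by (fastforce simp: map_comp_def ran_def split: option.splits)
  next
    fix x y z
    assume y: "y \<in> Omega n" and h: "x \<le> y \<and> y \<le> z \<and> x \<in> ran ?c \<and> z \<in> ran ?c"
    have "\<exists>u. \<beta> u = Some p \<and> u \<in> ran \<alpha>" if "p \<in> ran ?c" for p
      using that by (fastforce simp: map_comp_def ran_def split: option.splits)
    with h obtain u w where u: "\<beta> u = Some x" "u \<in> ran \<alpha>" and w: "\<beta> w = Some z" "w \<in> ran \<alpha>"
      by metis
    show "y \<in> ran ?c"
    proof (cases "y = x \<or> y = z")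
      case True
      with h show ?thesis by auto
    next
      case False
      have "y \<in> ran \<beta>"
        by (rule rb[of x z]) (use h y ranI[of \<beta> u x] ranI[of \<beta> w z] u(1) w(1) in simp_all)
      then obtain v where v: "\<beta> v = Some y" by (auto simp: ran_def)
      then have "v \<in> Omega n" using subb(1) by blast
      moreover have "u \<le> v" "v \<le> w"
        using False h opb[OF v u(1)] opb[OF w(1) v] by linarith+
      ultimately have "v \<in> ran \<alpha>" using ra[OF u(2) w(2)] by simp
      then obtain t where "\<alpha> t = Some v" by (auto simp: ran_def)
      with v have "?c t = Some y" by simp
      then show ?thesis by (rule ranI[of ?c t y])
    qed
  qed
  from op dom ran show "\<alpha> \<otimes>\<^bsub>PIO n\<^esub> \<beta> \<in> carrier (PIO n)"
    by (simp add: PIO_def)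
next
  show "\<one>\<^bsub>PIO n\<^esub> \<in> carrier (PIO n)"
    by (auto simp: PIO_def order_preserving_def is_interval_of_def ran_def restrict_map_def
        split: if_splits)
next
  fix \<alpha> assume "\<alpha> \<in> carrier (PIO n)"
  then have sub: "dom \<alpha> \<subseteq> Omega n" "ran \<alpha> \<subseteq> Omega n"
    by (auto simp: PIO_def is_interval_of_def)
  have "x \<notin> Omega n \<Longrightarrow> \<alpha> x = None" "\<alpha> x = Some v \<Longrightarrow> v \<in> Omega n" for x v
    using subsetD[OF sub(1), of x] subsetD[OF sub(2), of v] ranI[of \<alpha> x v] by auto
  then show "\<one>\<^bsub>PIO n\<^esub> \<otimes>\<^bsub>PIO n\<^esub> \<alpha> = \<alpha>" "\<alpha> \<otimes>\<^bsub>PIO n\<^esub> \<one>\<^bsub>PIO n\<^esub> = \<alpha>"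
    by (auto simp: PIO_def fun_eq_iff map_comp_def restrict_map_def split: option.splits)
qed (auto simp: PIO_def fun_eq_iff map_comp_def split: option.splits)

end

theory Submission
  imports Defs
begin

text \<open>Regularity of \<open>\<alpha>\<close> means that some \<open>\<beta>\<close> in the monoid is a section of \<open>\<alpha>\<close> over its image:
  \<open>\<beta>\<close> sends each \<open>y\<close> in the image of \<open>\<alpha>\<close> to a point of the fibre \<open>y\<alpha>\<inverse>\<close>. Such a
  section automatically preserves the order; the only real constraint is that its image be an
  interval.

  This constraint forbids a fibre with two points over an \<open>x\<close> strictly inside the image. There
  \<open>x - 1\<close> and \<open>x + 1\<close> are also in the image, so the section has values on both sides of
  the fibre \<open>x\<alpha>\<inverse>\<close>; its image, an interval, then contains the whole fibre, whereas by
  monotonicity only \<open>x\<close> can be sent there (lemma \<open>fibre_singleton_if_regular\<close>).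

  Conversely, if only the two extreme fibres are large, choose in the lowest fibre its greatest
  point and in every other fibre its least point. The chosen points are consecutive, so they form an
  interval and define a section (lemma \<open>regular_if_inner_fibres_singleton\<close>).

  The conditions on the domain and on the image agree for each single \<open>x\<close>, because \<open>\<alpha>\<close> sends
  the endpoints of its domain to the endpoints of its image
  (lemma \<open>fibre_meets_dom_ends_iff\<close>).\<close>

lemma PIO_mono:
  assumes "\<alpha> \<in> carrier (PIO n)" "\<alpha> x = Some u" "\<alpha> y = Some v" "x \<le> y"
  shows "u \<le> v"
proof -
  have "order_preserving \<alpha>" using assms(1) by (simp add: PIO_def)
  then show ?thesis using assms(2-4) unfolding order_preserving_def by (metis domI option.sel)
qed

lemma PIO_reflects_less:
  assumes "\<alpha> \<in> carrier (PIO n)" "\<alpha> x = Some u" "\<alpha> y = Some v" "u < v"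
  shows "x < y"
  using PIO_mono[OF assms(1,3,2)] assms(4) by linarith

lemma PIO_dom_ran_subset:
  assumes "\<alpha> \<in> carrier (PIO n)"
  shows "dom \<alpha> \<subseteq> Omega n" "ran \<alpha> \<subseteq> Omega n"
  using assms by (auto simp: PIO_def is_interval_of_def)

lemma PIO_finite:
  assumes "\<alpha> \<in> carrier (PIO n)"
  shows "finite (dom \<alpha>)" "finite (ran \<alpha>)"
  using PIO_dom_ran_subset[OF assms] by (auto simp: Omega_def intro: finite_subset)

lemma interval_between:
  assumes "is_interval_of (Omega n) I" "x \<in> I" "z \<in> I" "x \<le> y" "y \<le> z"
  shows "y \<in> I"
proof -
  have "x \<in> Omega n" "z \<in> Omega n" using assms by (auto simp: is_interval_of_def)
  moreover from this have "y \<in> Omega n" using assms by (auto simp: Omega_def)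
  ultimately show ?thesis using assms unfolding is_interval_of_def by blast
qed

lemma PIO_dom_between:
  assumes "\<alpha> \<in> carrier (PIO n)" "x \<in> dom \<alpha>" "z \<in> dom \<alpha>" "x \<le> y" "y \<le> z"
  shows "y \<in> dom \<alpha>"
  using assms interval_between[of n "dom \<alpha>" x z y] by (simp add: PIO_def)

lemma PIO_ran_between:
  assumes "\<alpha> \<in> carrier (PIO n)" "x \<in> ran \<alpha>" "z \<in> ran \<alpha>" "x \<le> y" "y \<le> z"
  shows "y \<in> ran \<alpha>"
  using assms interval_between[of n "ran \<alpha>" x z y] by (simp add: PIO_def)

lemma PIO_maps_Min:
  assumes \<alpha>: "\<alpha> \<in> carrier (PIO n)" and ne: "dom \<alpha> \<noteq> {}"
  shows "\<alpha> (Min (dom \<alpha>)) = Some (Min (ran \<alpha>))"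
proof -
  have "Min (dom \<alpha>) \<in> dom \<alpha>" using PIO_finite[OF \<alpha>] ne by simp
  then obtain u where u: "\<alpha> (Min (dom \<alpha>)) = Some u" by blast
  have "Min (ran \<alpha>) = u"
  proof (rule Min_eqI)
    fix v assume "v \<in> ran \<alpha>"
    then obtain z where z: "\<alpha> z = Some v" by (auto simp: ran_def)
    then have "Min (dom \<alpha>) \<le> z" using PIO_finite[OF \<alpha>] by (auto intro: Min_le)
    then show "u \<le> v" using PIO_mono[OF \<alpha> u z] by simp
  qed (use PIO_finite[OF \<alpha>] ranI[of \<alpha> "Min (dom \<alpha>)" u] u in auto)
  with u show ?thesis by simp
qed

lemma PIO_maps_Max:
  assumes \<alpha>: "\<alpha> \<in> carrier (PIO n)" and ne: "dom \<alpha> \<noteq> {}"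
  shows "\<alpha> (Max (dom \<alpha>)) = Some (Max (ran \<alpha>))"
proof -
  have "Max (dom \<alpha>) \<in> dom \<alpha>" using PIO_finite[OF \<alpha>] ne by simp
  then obtain u where u: "\<alpha> (Max (dom \<alpha>)) = Some u" by blast
  have "Max (ran \<alpha>) = u"
  proof (rule Max_eqI)
    fix v assume "v \<in> ran \<alpha>"
    then obtain z where z: "\<alpha> z = Some v" by (auto simp: ran_def)
    then have "z \<le> Max (dom \<alpha>)" using PIO_finite[OF \<alpha>] by (auto intro: Max_ge)
    then show "v \<le> u" using PIO_mono[OF \<alpha> z u] by simp
  qed (use PIO_finite[OF \<alpha>] ranI[of \<alpha> "Max (dom \<alpha>)" u] u in auto)
  with u show ?thesis by simp
qed

lemma fibre_meets_dom_ends_iff: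
  assumes \<alpha>: "\<alpha> \<in> carrier (PIO n)" and x: "x \<in> ran \<alpha>"
  shows "preimage \<alpha> x \<inter> {Min (dom \<alpha>), Max (dom \<alpha>)} \<noteq> {} \<longleftrightarrow> x \<in> {Min (ran \<alpha>), Max (ran \<alpha>)}"
proof -
  have "dom \<alpha> \<noteq> {}" using x by (auto simp: ran_def)
  then show ?thesis
    using PIO_maps_Min[OF \<alpha>] PIO_maps_Max[OF \<alpha>] by (auto simp: preimage_def)
qed

text \<open>In \<open>\<alpha> = \<alpha>\<beta>\<alpha>\<close> the factor \<open>\<beta>\<close> is only ever applied to points of the image of \<open>\<alpha>\<close>, and
  there the equation says exactly that \<open>\<beta>\<close> is a section of \<open>\<alpha>\<close>.\<close>

lemma regular_element_iff_section:
  assumes "\<alpha> \<in> carrier (PIO n)"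
  shows "regular_element (PIO n) \<alpha> \<longleftrightarrow>
    (\<exists>\<beta>\<in>carrier (PIO n). \<forall>y\<in>ran \<alpha>. \<exists>t. \<beta> y = Some t \<and> \<alpha> t = Some y)"
proof -
  have "\<alpha> = \<alpha> \<circ>\<^sub>m (\<beta> \<circ>\<^sub>m \<alpha>) \<longleftrightarrow> (\<forall>y\<in>ran \<alpha>. \<exists>t. \<beta> y = Some t \<and> \<alpha> t = Some y)" for \<beta>
  proof
    assume eq: "\<alpha> = \<alpha> \<circ>\<^sub>m (\<beta> \<circ>\<^sub>m \<alpha>)"
    show "\<forall>y\<in>ran \<alpha>. \<exists>t. \<beta> y = Some t \<and> \<alpha> t = Some y"
    proof
      fix y assume "y \<in> ran \<alpha>"
      then obtain x where x: "\<alpha> x = Some y" by (auto simp: ran_def)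
      have "(\<alpha> \<circ>\<^sub>m (\<beta> \<circ>\<^sub>m \<alpha>)) x = Some y"
        by (rule trans[OF fun_cong[OF eq[symmetric], of x] x])
      then show "\<exists>t. \<beta> y = Some t \<and> \<alpha> t = Some y"
        using x by (auto simp: map_comp_Some_iff)
    qed
  next
    assume sec: "\<forall>y\<in>ran \<alpha>. \<exists>t. \<beta> y = Some t \<and> \<alpha> t = Some y"
    show "\<alpha> = \<alpha> \<circ>\<^sub>m (\<beta> \<circ>\<^sub>m \<alpha>)"
    proof
      fix x
      show "\<alpha> x = (\<alpha> \<circ>\<^sub>m (\<beta> \<circ>\<^sub>m \<alpha>)) x"
      proof (cases "\<alpha> x")
        case (Some y)
        then have "y \<in> ran \<alpha>" by (rule ranI[of \<alpha> x y])
        then obtain t where "\<beta> y = Some t" "\<alpha> t = Some y" using sec by blast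
        with Some show ?thesis by simp
      qed (simp add: map_comp_def)
    qed
  qed
  then show ?thesis using assms by (simp add: regular_element_def PIO_def)
qed

text \<open>Two points \<open>u < v\<close> of the fibre over an inner \<open>x\<close> would both be values of the
  section, trapped strictly between its values at \<open>x - 1\<close> and \<open>x + 1\<close>; but \<open>x\<close> is the only
  argument strictly between \<open>x - 1\<close> and \<open>x + 1\<close>.\<close>

lemma fibre_singleton_if_regular:
  assumes \<alpha>: "\<alpha> \<in> carrier (PIO n)" and reg: "regular_element (PIO n) \<alpha>"
    and x: "x \<in> ran \<alpha>" and inner: "x \<noteq> Min (ran \<alpha>)" "x \<noteq> Max (ran \<alpha>)"
    and u: "\<alpha> u = Some x" and v: "\<alpha> v = Some x"
  shows "u = v"
proof -
  obtain \<beta> where \<beta>: "\<beta> \<in> carrier (PIO n)"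
    and sec: "\<And>y. y \<in> ran \<alpha> \<Longrightarrow> \<exists>t. \<beta> y = Some t \<and> \<alpha> t = Some y"
    using reg regular_element_iff_section[OF \<alpha>] by blast
  have fin: "finite (ran \<alpha>)" and ne: "ran \<alpha> \<noteq> {}" using PIO_finite[OF \<alpha>] x by auto
  have lt: "Min (ran \<alpha>) < x" "x < Max (ran \<alpha>)"
    using inner Min_le[OF fin x] Max_ge[OF fin x] by linarith+
  have "x - 1 \<in> ran \<alpha>"
    using PIO_ran_between[OF \<alpha> Min_in[OF fin ne] x, of "x - 1"] lt by simp
  then obtain l where l: "\<beta> (x - 1) = Some l" "\<alpha> l = Some (x - 1)" using sec by blast
  have "x + 1 \<in> ran \<alpha>"
    using PIO_ran_between[OF \<alpha> x Max_in[OF fin ne], of "x + 1"] lt by simp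
  then obtain r where r: "\<beta> (x + 1) = Some r" "\<alpha> r = Some (x + 1)" using sec by blast
  have "\<beta> x = Some w" if w: "\<alpha> w = Some x" for w
  proof -
    have "l < w" using PIO_reflects_less[OF \<alpha> l(2) w] lt by simp
    moreover have "w < r" using PIO_reflects_less[OF \<alpha> w r(2)] by simp
    ultimately have "w \<in> ran \<beta>"
      using PIO_ran_between[OF \<beta> ranI[of \<beta> "x - 1" l] ranI[of \<beta> "x + 1" r], of w] l(1) r(1)
      by simp
    then obtain p where p: "\<beta> p = Some w" by (auto simp: ran_def)
    have "x - 1 < p" using PIO_reflects_less[OF \<beta> l(1) p] \<open>l < w\<close> by simp
    moreover have "p < x + 1" using PIO_reflects_less[OF \<beta> p r(1)] \<open>w < r\<close> by simp
    ultimately have "p = x" by linarith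
    with p show ?thesis by simp
  qed
  from this[OF u] this[OF v] show ?thesis by simp
qed

text \<open>A sufficient criterion for regularity in which monotonicity of the section has been
  eliminated: it follows from that of \<open>\<alpha>\<close>, since smaller image points have lower fibres.\<close>

lemma regular_if_interval_of_representatives:
  assumes \<alpha>: "\<alpha> \<in> carrier (PIO n)"
    and sec: "\<And>y. y \<in> ran \<alpha> \<Longrightarrow> \<alpha> (s y) = Some y"
    and int: "is_interval_of (Omega n) (s ` ran \<alpha>)"
  shows "regular_element (PIO n) \<alpha>"
proof -
  define \<beta> where "\<beta> y = (if y \<in> ran \<alpha> then Some (s y) else None)" for y
  have dom: "dom \<beta> = ran \<alpha>" and ran: "ran \<beta> = s ` ran \<alpha>"
    by (auto simp: \<beta>_def dom_def ran_def[of \<beta>] split: if_splits)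
  have "order_preserving \<beta>"
    unfolding order_preserving_def dom
  proof (intro ballI impI)
    fix x y assume x: "x \<in> ran \<alpha>" and y: "y \<in> ran \<alpha>" and "x \<le> y"
    then have "s x \<le> s y"
      using PIO_reflects_less[OF \<alpha> sec[OF x] sec[OF y]] by (cases "x = y") auto
    then show "the (\<beta> x) \<le> the (\<beta> y)" using x y by (simp add: \<beta>_def)
  qed
  moreover have "is_interval_of (Omega n) (ran \<alpha>)" using \<alpha> by (simp add: PIO_def)
  ultimately have "\<beta> \<in> carrier (PIO n)" using int by (simp add: PIO_def dom ran)
  moreover have "\<forall>y\<in>ran \<alpha>. \<exists>t. \<beta> y = Some t \<and> \<alpha> t = Some y" using sec by (simp add: \<beta>_def)
  ultimately show ?thesis using regular_element_iff_section[OF \<alpha>] by blast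
qed

text \<open>The representatives are chosen as close as possible to the middle of the domain: the greatest
  point of the lowest fibre and the least point of the highest one. Over the inner points the fibres
  are singletons, so that either choice works; taking the minimum everywhere except over the least
  image point also covers an image with a single point.\<close>

lemma regular_if_inner_fibres_singleton:
  assumes \<alpha>: "\<alpha> \<in> carrier (PIO n)"
    and big: "\<forall>x\<in>ran \<alpha>. card (preimage \<alpha> x) > 1 \<longrightarrow> x \<in> {Min (ran \<alpha>), Max (ran \<alpha>)}"
  shows "regular_element (PIO n) \<alpha>"
proof -
  define s where
    "s y = (if y = Min (ran \<alpha>) then Max (preimage \<alpha> y) else Min (preimage \<alpha> y))" for y
  have fin: "finite (preimage \<alpha> y)" for y
    using PIO_finite(1)[OF \<alpha>] by (simp add: preimage_def)
  have finr: "finite (ran \<alpha>)" using PIO_finite(2)[OF \<alpha>] .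
  have s_in: "s y \<in> preimage \<alpha> y" if "y \<in> ran \<alpha>" for y
  proof -
    have "preimage \<alpha> y \<noteq> {}" using that by (auto simp: preimage_def ran_def)
    then show ?thesis unfolding s_def using Max_in[OF fin, of y] Min_in[OF fin, of y] by presburger
  qed
  then have sec: "\<alpha> (s y) = Some y" if "y \<in> ran \<alpha>" for y
    using that by (simp add: preimage_def)
  have "w \<in> s ` ran \<alpha>"
    if p: "p \<in> ran \<alpha>" and q: "q \<in> ran \<alpha>" and le: "s p \<le> w" "w \<le> s q" for p q w
  proof -
    have "w \<in> dom \<alpha>" by (rule PIO_dom_between[OF \<alpha> domI domI]) (use sec p q le in auto)
    then obtain y where y: "\<alpha> w = Some y" by blast
    then have yr: "y \<in> ran \<alpha>" and wy: "w \<in> preimage \<alpha> y" by (auto simp: preimage_def intro: ranI)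
    have "p \<le> y" "y \<le> q" using PIO_mono[OF \<alpha> sec[OF p] y] PIO_mono[OF \<alpha> y sec[OF q]] le by auto
    consider "card (preimage \<alpha> y) \<le> 1" | "y = Min (ran \<alpha>)"
      | "y \<noteq> Min (ran \<alpha>)" "y = Max (ran \<alpha>)"
      using big yr by fastforce
    then have "s y = w"
    proof cases
      case 1
      then show ?thesis using card_le_Suc0_iff_eq[OF fin, of y] wy s_in[OF yr] by auto
    next
      case 2
      (* w lies in the lowest fibre, hence so does s p, which is the greatest point there. *)
      then have "p = y" using \<open>p \<le> y\<close> Min_le[OF finr p] by simp
      moreover have "w \<le> s y" using 2 Max_ge[OF fin wy] unfolding s_def by presburger
      ultimately show ?thesis using le by simp
    next
      case 3
      (* Dually, w and s q lie in the highest fibre, whose least point is s q. *)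
      then have "q = y" using \<open>y \<le> q\<close> Max_ge[OF finr q] by simp
      moreover have "s y \<le> w" using 3 Min_le[OF fin wy] unfolding s_def by presburger
      ultimately show ?thesis using le by simp
    qed
    then show ?thesis using yr by blast
  qed
  moreover have "s ` ran \<alpha> \<subseteq> Omega n" using sec PIO_dom_ran_subset(1)[OF \<alpha>] by blast
  ultimately have "is_interval_of (Omega n) (s ` ran \<alpha>)"
    unfolding is_interval_of_def by blast
  then show ?thesis using regular_if_interval_of_representatives[OF \<alpha>] sec by blast
qed

theorem proposition6:
  fixes n :: nat and \<alpha> :: "nat \<rightharpoonup> nat"
  assumes "n \<ge> 1"
    and "\<alpha> \<in> carrier (PIO n)"
  shows
    "(regular_element (PIO n) \<alpha> \<longleftrightarrow>
       (\<forall>x\<in>ran \<alpha>. card (preimage \<alpha> x) > 1 \<longrightarrow>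
          preimage \<alpha> x \<inter> {Min (dom \<alpha>), Max (dom \<alpha>)} \<noteq> {})) \<and>
     ((\<forall>x\<in>ran \<alpha>. card (preimage \<alpha> x) > 1 \<longrightarrow>
          preimage \<alpha> x \<inter> {Min (dom \<alpha>), Max (dom \<alpha>)} \<noteq> {}) \<longleftrightarrow>
       (\<forall>x\<in>ran \<alpha>. card (preimage \<alpha> x) > 1 \<longrightarrow> x \<in> {Min (ran \<alpha>), Max (ran \<alpha>)}))"
    (is "(?reg \<longleftrightarrow> ?dom_ends) \<and> (?dom_ends \<longleftrightarrow> ?ran_ends)")
proof -
  note \<alpha> = assms(2)
  have ends: "?dom_ends \<longleftrightarrow> ?ran_ends"
    by (intro ball_cong refl) (simp only: fibre_meets_dom_ends_iff[OF \<alpha>])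
  have "?ran_ends" if reg: "?reg"
  proof (intro ballI impI, rule ccontr)
    fix x
    assume x: "x \<in> ran \<alpha>" and big: "card (preimage \<alpha> x) > 1"
      and "x \<notin> {Min (ran \<alpha>), Max (ran \<alpha>)}"
    then have "u = v" if "\<alpha> u = Some x" "\<alpha> v = Some x" for u v
      using fibre_singleton_if_regular[OF \<alpha> reg x] that by blast
    moreover have "finite (preimage \<alpha> x)" using PIO_finite(1)[OF \<alpha>] by (simp add: preimage_def)
    ultimately have "card (preimage \<alpha> x) \<le> Suc 0"
      by (auto simp: card_le_Suc0_iff_eq preimage_def)
    with big show False by simp
  qed
  with ends regular_if_inner_fibres_singleton[OF \<alpha>] show ?thesis by blast
qed

end
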